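(* Let $\Sigma$ be an alphabet and $w$ a word over $\Sigma$. If $u$ and $v$ are both primitive generators of $w$, then $u = v$ or $u = \tilde{v}$. (That is, the primitive generator of any word is unique up to reversal.)
   Context: For integers $i,k$, $[i,k]=\{j\in\mathbb{Z} : i\le j\le k\}$. For a word $u=a_1\cdots a_n$ over $\Sigma$ and a function $f\colon[1,m]\to[1,n]$, $u^f$ denotes the word $a_{f(1)}\cdots a_{f(m)}$. A walk is a surjection $f\colon[1,m]\to[1,n]$ with $|f(i+1)-f(i)|\le 1$ for all $1\le i<m$. A word $u$ generates a word $w$ if $w=u^f$ for some walk $f$. The reversal of $u=a_1\cdots a_n$ is $\tilde{u}=a_n\cdots a_1$. A word $u$ is primitive if it is not generated by any word strictly shorter than itself. A primitive generator of $w$ is a primitive word that generates $w$. *)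

theory Defs
  imports Main
begin

(* f is given on all of nat; only its values on {1..m} matter. The case m = n = 0
   (the empty walk) is included. *)
definition walk :: "nat \<Rightarrow> nat \<Rightarrow> (nat \<Rightarrow> nat) \<Rightarrow> bool" where
  "walk m n f \<longleftrightarrow>
     f ` {1..m} = {1..n} \<and>
     (\<forall>i. 1 \<le> i \<and> i < m \<longrightarrow> \<bar>int (f (i + 1)) - int (f i)\<bar> \<le> 1)"

(* The word u^f = a_{f(1)} ... a_{f(m)}, where u = a_1 ... a_n. Lists are 0-indexed,
   so a_j is u ! (j - 1). *)
definition word_along :: "'a list \<Rightarrow> nat \<Rightarrow> (nat \<Rightarrow> nat) \<Rightarrow> 'a list" where
  "word_along u m f = map (\<lambda>i. u ! (f i - 1)) [1..<m + 1]"

definition generates :: "'a list \<Rightarrow> 'a list \<Rightarrow> bool" where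
  "generates u w \<longleftrightarrow> (\<exists>m f. walk m (length u) f \<and> w = word_along u m f)"

definition primitive_word :: "'a list \<Rightarrow> bool" where
  "primitive_word u \<longleftrightarrow> \<not> (\<exists>v. length v < length u \<and> generates v u)"

definition primitive_generator :: "'a list \<Rightarrow> 'a list \<Rightarrow> bool" where
  "primitive_generator u w \<longleftrightarrow> primitive_word u \<and> generates u w"

end

theory Submission
  imports Defs
begin

text \<open>
  Induction on the length of \<open>w\<close>. A word can be shortened at a stutter (two equal adjacent letters)
  or at a fold of length \<open>l\<close>: a palindromic prefix or suffix of length \<open>2 l + 1\<close>, or palindromes of
  radius \<open>l\<close> around two positions at distance \<open>l\<close> (a factor \<open>y y' y\<close> with \<open>y'\<close> the reversal of \<open>y\<close>
  and the shared letters overlapping). Primitive words contain none of these.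

  If \<open>w\<close> has no stutter, take a fold of minimal length \<open>l\<close>. In any walk generating \<open>w\<close>, every turn
  is the centre of a palindrome of radius \<open>l\<close> in \<open>w\<close>, and by minimality distinct such centres are at
  least \<open>l\<close> apart. So near the fold the walk can turn only at the centres of the fold, and cutting
  the fold out of \<open>w\<close> leaves a walk on the same generator \<open>u\<close>. This walk is still onto, since
  otherwise \<open>u\<close> would have a palindromic prefix or suffix. Hence every primitive generator
  of \<open>w\<close> generates the same shorter word. If there is neither a stutter nor a fold, walks
  have no turns and the only generators are \<open>w\<close> and its reversal.
\<close>

section \<open>Labelled walks, reversal and images of walks\<close>

text \<open>The walk length is tied to \<open>length w\<close>, and
  \<open>w = word_along u m f\<close> is spelled out letter by letter, so that walks can be built
  and cut without computing with \<open>map\<close> and \<open>upt\<close>.\<close>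

definition labelled_walk :: "'a list \<Rightarrow> 'a list \<Rightarrow> (nat \<Rightarrow> nat) \<Rightarrow> bool" where
  "labelled_walk u w f \<longleftrightarrow>
     walk (length w) (length u) f \<and> (\<forall>i. 1 \<le> i \<and> i \<le> length w \<longrightarrow> w ! (i - 1) = u ! (f i - 1))"

lemma labelled_walkD:
  assumes "labelled_walk u w f"
  shows "f ` {1..length w} = {1..length u}"
    and "\<And>i. 1 \<le> i \<Longrightarrow> i < length w \<Longrightarrow> \<bar>int (f (i + 1)) - int (f i)\<bar> \<le> 1"
    and "\<And>i. 1 \<le> i \<Longrightarrow> i \<le> length w \<Longrightarrow> w ! (i - 1) = u ! (f i - 1)"
    and "\<And>i. 1 \<le> i \<Longrightarrow> i \<le> length w \<Longrightarrow> 1 \<le> f i \<and> f i \<le> length u"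
proof -
  show *: "f ` {1..length w} = {1..length u}"
    using assms by (simp add: labelled_walk_def walk_def)
  show "\<And>i. 1 \<le> i \<Longrightarrow> i < length w \<Longrightarrow> \<bar>int (f (i + 1)) - int (f i)\<bar> \<le> 1"
    and "\<And>i. 1 \<le> i \<Longrightarrow> i \<le> length w \<Longrightarrow> w ! (i - 1) = u ! (f i - 1)"
    using assms by (simp_all add: labelled_walk_def walk_def)
  show "1 \<le> f i \<and> f i \<le> length u" if "1 \<le> i" "i \<le> length w" for i
  proof -
    have "f i \<in> f ` {1..length w}" using that by auto
    then show ?thesis unfolding * by auto
  qed
qed

lemma generates_iff_labelled_walk: "generates u w \<longleftrightarrow> (\<exists>f. labelled_walk u w f)"
proof
  assume "generates u w"
  then obtain m f where f: "walk m (length u) f" and w: "w = word_along u m f"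
    by (auto simp: generates_def)
  have "length w = m" by (simp add: w word_along_def)
  moreover have "w ! (i - 1) = u ! (f i - 1)" if "1 \<le> i" "i \<le> length w" for i
  proof -
    have "[1..<m + 1] ! (i - 1) = i" using that \<open>length w = m\<close> by (subst nth_upt) auto
    then show ?thesis using that \<open>length w = m\<close> by (simp add: w word_along_def del: upt_Suc)
  qed
  ultimately have "labelled_walk u w f" using f by (simp add: labelled_walk_def)
  then show "\<exists>f. labelled_walk u w f" by blast
next
  assume "\<exists>f. labelled_walk u w f"
  then obtain f where f: "labelled_walk u w f" ..
  have "w = word_along u (length w) f"
  proof (rule nth_equalityI)
    fix j assume j: "j < length w"
    then have "[1..<length w + 1] ! j = j + 1" by (subst nth_upt) auto
    then show "w ! j = word_along u (length w) f ! j"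
      using labelled_walkD(3)[OF f, of "j + 1"] j by (simp add: word_along_def del: upt_Suc)
  qed (simp add: word_along_def del: upt_Suc)
  with f show "generates u w" by (auto simp: generates_def labelled_walk_def)
qed

text \<open>Run the walk backwards. This later reduces suffixes to prefixes.\<close>

lemma generates_rev:
  assumes "generates u w"
  shows "generates u (rev w)"
proof -
  obtain f where f: "labelled_walk u w f"
    using assms by (auto simp: generates_iff_labelled_walk)
  let ?m = "length w"
  let ?g = "\<lambda>i. f (?m + 1 - i)"
  have "(\<lambda>i. ?m + 1 - i) ` {1..?m} = {1..?m}"
  proof
    show "{1..?m} \<subseteq> (\<lambda>i. ?m + 1 - i) ` {1..?m}"
    proof
      fix x assume "x \<in> {1..?m}"
      then show "x \<in> (\<lambda>i. ?m + 1 - i) ` {1..?m}"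
        by (intro image_eqI[where x = "?m + 1 - x"]) auto
    qed
  qed auto
  then have "?g ` {1..?m} = {1..length u}"
    using labelled_walkD(1)[OF f] by (metis image_image)
  moreover have "\<bar>int (?g (i + 1)) - int (?g i)\<bar> \<le> 1" if "1 \<le> i" "i < ?m" for i
  proof -
    have "?m - i + 1 = ?m + 1 - i" "?m + 1 - (i + 1) = ?m - i" using that by auto
    then show ?thesis
      using labelled_walkD(2)[OF f, of "?m - i"] that by (simp add: abs_minus_commute)
  qed
  moreover have "rev w ! (i - 1) = u ! (?g i - 1)" if "1 \<le> i" "i \<le> ?m" for i
  proof -
    have "rev w ! (i - 1) = w ! (?m + 1 - i - 1)" using that by (simp add: rev_nth)
    also have "\<dots> = u ! (?g i - 1)"
      using that by (intro labelled_walkD(3)[OF f]) auto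
    finally show ?thesis .
  qed
  ultimately have "labelled_walk u (rev w) ?g" by (simp add: labelled_walk_def walk_def)
  then show ?thesis by (auto simp: generates_iff_labelled_walk)
qed

lemma primitive_word_rev: "primitive_word u \<Longrightarrow> primitive_word (rev u)"
  unfolding primitive_word_def using generates_rev by (metis length_rev rev_rev_ident)

text \<open>Discrete intermediate value property: steps of size at most 1 cannot jump over
  \<open>y\<close>, so a walk avoiding \<open>y\<close> stays on the side of \<open>y\<close> where
  it starts.\<close>

lemma walk_image_interval:
  fixes f :: "nat \<Rightarrow> nat"
  assumes step: "\<And>i. 1 \<le> i \<Longrightarrow> i < m \<Longrightarrow> \<bar>int (f (i + 1)) - int (f i)\<bar> \<le> 1"
    and x: "x \<in> f ` {1..m}" and z: "z \<in> f ` {1..m}" and "x \<le> y" "y \<le> z"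
  shows "y \<in> f ` {1..m}"
proof (rule ccontr)
  assume y: "y \<notin> f ` {1..m}"
  have below: "f (Suc 0) < y \<Longrightarrow> f i < y" if "1 \<le> i" "i \<le> m" for i
    using that
  proof (induction i rule: dec_induct)
    case (step i)
    have "f (i + 1) \<noteq> y" using y step by auto
    then show ?case using step assms(1)[of i] by auto
  qed simp
  have above: "f (Suc 0) > y \<Longrightarrow> f i > y" if "1 \<le> i" "i \<le> m" for i
    using that
  proof (induction i rule: dec_induct)
    case (step i)
    have "f (i + 1) \<noteq> y" using y step by auto
    then show ?case using step assms(1)[of i] by auto
  qed simp
  obtain i k where ik: "1 \<le> i" "i \<le> m" "x = f i" "1 \<le> k" "k \<le> m" "z = f k"
    using x z by auto
  then have "Suc 0 \<in> {1..m}" by auto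
  then have "f (Suc 0) \<noteq> y" using y by blast
  then show False
    using above[of i] below[of k] ik \<open>x \<le> y\<close> \<open>y \<le> z\<close> by linarith
qed

section \<open>Palindromes and stutters that make a word non-primitive\<close>

text \<open>Centre \<open>c\<close> and radius \<open>k\<close>, with positions counted from 1 as
  for walks. By \<open>k < c\<close> the left end \<open>c - k\<close> is at least 1, so the
  subtractions never truncate.\<close>

definition palindrome_at :: "'a list \<Rightarrow> nat \<Rightarrow> nat \<Rightarrow> bool" where
  "palindrome_at w c k \<longleftrightarrow>
     k < c \<and> c + k \<le> length w \<and> (\<forall>i\<le>k. w ! (c - i - 1) = w ! (c + i - 1))"

lemma palindrome_at_mono: "palindrome_at w c k \<Longrightarrow> j \<le> k \<Longrightarrow> palindrome_at w c j"
  by (auto simp: palindrome_at_def)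

lemma palindrome_at_rev:
  assumes "palindrome_at w c k"
  shows "palindrome_at (rev w) (length w + 1 - c) k"
proof -
  let ?m = "length w"
  have kc: "k < c" "c + k \<le> ?m" and e: "\<And>i. i \<le> k \<Longrightarrow> w ! (c - i - 1) = w ! (c + i - 1)"
    using assms by (auto simp: palindrome_at_def)
  have "rev w ! (?m + 1 - c - i - 1) = rev w ! (?m + 1 - c + i - 1)" if "i \<le> k" for i
  proof -
    have "rev w ! (?m + 1 - c - i - 1) = w ! (c + i - 1)"
      using kc that by (subst rev_nth) (auto intro!: arg_cong[where f = "(!) w"])
    moreover have "rev w ! (?m + 1 - c + i - 1) = w ! (c - i - 1)"
      using kc that by (subst rev_nth) (auto intro!: arg_cong[where f = "(!) w"])
    ultimately show ?thesis using e[OF that] by simp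
  qed
  then show ?thesis using kc by (auto simp: palindrome_at_def)
qed

text \<open>\<open>drop l u\<close> generates \<open>u\<close>: the walk \<open>?g\<close> starts at
  its position \<open>l + 1\<close>, runs down to 1, which is the centre of the palindrome, and then
  runs up to the end.\<close>

lemma palindrome_prefix_not_primitive:
  assumes l: "1 \<le> l" and pal: "palindrome_at u (l + 1) l"
  shows "\<not> primitive_word u"
proof -
  let ?n = "length u"
  let ?g = "\<lambda>i. if i \<le> l then l + 2 - i else i - l"
  have n: "l + 1 + l \<le> ?n" and e: "\<And>i. i \<le> l \<Longrightarrow> u ! (l + 1 - i - 1) = u ! (l + 1 + i - 1)"
    using pal by (auto simp: palindrome_at_def)
  have "?g ` {1..?n} = {1..?n - l}"
  proof
    show "?g ` {1..?n} \<subseteq> {1..?n - l}" using n by auto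
    show "{1..?n - l} \<subseteq> ?g ` {1..?n}"
    proof
      fix x assume "x \<in> {1..?n - l}"
      then show "x \<in> ?g ` {1..?n}" by (intro image_eqI[where x = "x + l"]) auto
    qed
  qed
  moreover have "u ! (i - 1) = drop l u ! (?g i - 1)" if "1 \<le> i" "i \<le> ?n" for i
  proof (cases "i \<le> l")
    case True
    then show ?thesis using e[of "l + 1 - i"] that n by simp
  qed (use that n in auto)
  ultimately have "labelled_walk (drop l u) u ?g"
    unfolding labelled_walk_def walk_def by auto
  moreover have "length (drop l u) < length u" using l n by auto
  ultimately show ?thesis
    unfolding primitive_word_def generates_iff_labelled_walk by blast
qed

lemma palindrome_suffix_not_primitive:
  assumes l: "1 \<le> l" and pal: "palindrome_at u (length u - l) l"
  shows "\<not> primitive_word u"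
proof -
  have "length u + 1 - (length u - l) = l + 1" using pal by (auto simp: palindrome_at_def)
  then have "palindrome_at (rev u) (l + 1) l" using palindrome_at_rev[OF pal] by simp
  then show ?thesis using palindrome_prefix_not_primitive[OF l] primitive_word_rev by blast
qed

text \<open>Reflecting in \<open>s + l\<close> and then in \<open>s\<close> is a translation by
  \<open>2 * l\<close>.\<close>

lemma double_palindrome_period:
  assumes "palindrome_at w s l" "palindrome_at w (s + l) l" "i \<le> l"
  shows "w ! (s + l + i - 1) = w ! (s - l + i - 1)"
proof -
  have "w ! (s + l + i - 1) = w ! (s + l - i - 1)"
    using assms by (auto simp: palindrome_at_def)
  also have "\<dots> = w ! (s - (l - i) - 1)"
    using assms by (auto simp: palindrome_at_def dest: spec[of _ "l - i"])
  also have "s - (l - i) = s - l + i"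
    using assms by (auto simp: palindrome_at_def)
  finally show ?thesis .
qed

text \<open>Cutting out positions \<open>s + 1\<close> to \<open>s + 2 * l\<close> leaves a
  generator: the walk \<open>?g\<close> goes up to \<open>s\<close>, back down to
  \<open>s - l\<close>, and up again, reproducing the zigzag in \<open>u\<close>.\<close>

lemma double_palindrome_not_primitive:
  assumes l: "1 \<le> l" and pal: "palindrome_at u s l" "palindrome_at u (s + l) l"
  shows "\<not> primitive_word u"
proof -
  let ?n = "length u"
  let ?v = "take s u @ drop (s + 2 * l) u"
  let ?g = "\<lambda>i. if i \<le> s then i else if i \<le> s + l then 2 * s - i else i - 2 * l"
  have n: "l < s" "s + 2 * l \<le> ?n" and e: "\<And>i. i \<le> l \<Longrightarrow> u ! (s - i - 1) = u ! (s + i - 1)"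
    using pal by (auto simp: palindrome_at_def)
  have v: "?v ! (i - 1) = (if i \<le> s then u ! (i - 1) else u ! (i + 2 * l - 1))" if "1 \<le> i" for i
    using that n by (auto simp: nth_append min_def intro!: arg_cong[where f = "(!) u"])
  have "?g ` {1..?n} = {1..?n - 2 * l}"
  proof
    show "?g ` {1..?n} \<subseteq> {1..?n - 2 * l}" using n by auto
    show "{1..?n - 2 * l} \<subseteq> ?g ` {1..?n}"
    proof
      fix x assume x: "x \<in> {1..?n - 2 * l}"
      show "x \<in> ?g ` {1..?n}"
      proof (cases "x \<le> s")
        case True
        then show ?thesis using x by (intro image_eqI[where x = x]) auto
      next
        case False
        then show ?thesis using x by (intro image_eqI[where x = "x + 2 * l"]) auto
      qed
    qed
  qed
  moreover have "\<bar>int (?g (i + 1)) - int (?g i)\<bar> \<le> 1" if "1 \<le> i" "i < ?n" for i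
    using n by auto
  moreover have "u ! (i - 1) = ?v ! (?g i - 1)" if i: "1 \<le> i" "i \<le> ?n" for i
  proof -
    consider "i \<le> s" | "s < i" "i \<le> s + l" | "s + l < i" "i \<le> s + 2 * l" | "s + 2 * l < i"
      by linarith
    then show ?thesis
    proof cases
      case 2
      then have "u ! (i - 1) = u ! (2 * s - i - 1)" using e[of "i - s"] by (simp add: mult_2)
      then show ?thesis using v[of "2 * s - i"] 2 n by auto
    next
      case 3
      \<comment> \<open>The second upward run repeats the first one, shifted by the period
        \<open>2 * l\<close>.\<close>
      have "i = s + l + (i - s - l)" "i - 2 * l = s - l + (i - s - l)" using 3 n by auto
      then have "u ! (i - 1) = u ! (i - 2 * l - 1)"
        using double_palindrome_period[OF pal, of "i - s - l"] 3 by simp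
      then show ?thesis using v[of "i - 2 * l"] 3 n by auto
    next
      case 4
      then show ?thesis using v[of "i - 2 * l"] n by auto
    qed (use v i in auto)
  qed
  ultimately have "labelled_walk ?v u ?g"
    unfolding labelled_walk_def walk_def using n by auto
  moreover have "length ?v < length u" using l n by auto
  ultimately show ?thesis
    unfolding primitive_word_def generates_iff_labelled_walk by blast
qed

lemma stutter_not_primitive:
  assumes "1 \<le> i" "i < length u" "u ! (i - 1) = u ! i"
  shows "\<not> primitive_word u"
proof -
  let ?n = "length u"
  let ?v = "take i u @ drop (i + 1) u"
  let ?g = "\<lambda>j. if j \<le> i then j else j - 1"
  have "?g ` {1..?n} = {1..?n - 1}"
  proof
    show "?g ` {1..?n} \<subseteq> {1..?n - 1}" using assms by auto
    show "{1..?n - 1} \<subseteq> ?g ` {1..?n}"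
    proof
      fix x assume x: "x \<in> {1..?n - 1}"
      then show "x \<in> ?g ` {1..?n}"
        by (intro image_eqI[where x = "if x \<le> i then x else x + 1"]) auto
    qed
  qed
  moreover have "u ! (j - 1) = ?v ! (?g j - 1)" if j: "1 \<le> j" "j \<le> ?n" for j
  proof -
    consider "j \<le> i" | "j = i + 1" | "i + 1 < j" by linarith
    then show ?thesis
      using assms j by cases (auto simp: nth_append min_def intro!: arg_cong[where f = "(!) u"])
  qed
  ultimately have "labelled_walk ?v u ?g"
    unfolding labelled_walk_def walk_def using assms by auto
  moreover have "length ?v < length u" using assms by auto
  ultimately show ?thesis
    unfolding primitive_word_def generates_iff_labelled_walk by blast
qed

section \<open>Deleting a block of a word without changing its generator\<close>

text \<open>Positions \<open>a + 1\<close> to \<open>a + k\<close> are cut. \<open>closed\<close>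
  makes the junction a legal step. \<open>cover\<close> keeps the walk onto: either the rest visits
  all values of the block, or the block stays within \<open>l\<close> on one side of
  \<open>c\<close>, and missing any of it would make the palindrome around \<open>c\<close> a prefix
  or suffix of \<open>u\<close>.\<close>

lemma delete_block:
  assumes f: "labelled_walk u w f" and prim: "primitive_word u"
    and ak: "a + k \<le> length w" and closed: "a = 0 \<or> f a = f (a + k)"
    and l: "1 \<le> l"
    and c: "c \<in> f ` ({1..a} \<union> {a + k + 1..length w})"
    and cover: "f ` {a + 1..a + k} \<subseteq> f ` ({1..a} \<union> {a + k + 1..length w}) \<or>
      palindrome_at u c l \<and>
        (f ` {a + 1..a + k} \<subseteq> {c..c + l} \<or> f ` {a + 1..a + k} \<subseteq> {c - l..c})"
  shows "generates u (take a w @ drop (a + k) w)"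
proof -
  let ?m = "length w" and ?n = "length u"
  let ?g = "\<lambda>i. if i \<le> a then f i else f (i + k)"
  let ?J = "f ` ({1..a} \<union> {a + k + 1..?m})"
  let ?w = "take a w @ drop (a + k) w"
  have len: "length ?w = ?m - k" using ak by auto
  have J: "?g ` {1..?m - k} = ?J"
  proof
    show "?g ` {1..?m - k} \<subseteq> ?J" by auto
    show "?J \<subseteq> ?g ` {1..?m - k}"
    proof
      fix x assume "x \<in> ?J"
      then obtain i where i: "x = f i" "i \<in> {1..a} \<union> {a + k + 1..?m}" by auto
      show "x \<in> ?g ` {1..?m - k}"
      proof (cases "i \<le> a")
        case True
        then show ?thesis using i ak by (intro image_eqI[where x = i]) auto
      next
        case False
        then show ?thesis using i ak by (intro image_eqI[where x = "i - k"]) auto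
      qed
    qed
  qed
  have step: "\<bar>int (?g (i + 1)) - int (?g i)\<bar> \<le> 1" if i: "1 \<le> i" "i < ?m - k" for i
  proof -
    consider "i < a" | "i = a" | "i > a" by linarith
    then show ?thesis
    proof cases
      case 2
      then show ?thesis using closed i labelled_walkD(2)[OF f, of "a + k"] by (simp add: add_ac)
    next
      case 3
      then show ?thesis using i labelled_walkD(2)[OF f, of "i + k"] by (simp add: add_ac)
    qed (use i ak labelled_walkD(2)[OF f, of i] in auto)
  qed
  \<comment> \<open>The remaining values are the image of a walk, hence have no gaps.\<close>
  have interval: "y \<in> ?J" if "x \<in> ?J" "z \<in> ?J" "x \<le> y" "y \<le> z" for x y z
    using walk_image_interval[of "?m - k" ?g x z y, OF step] that unfolding J by blast
  have "{1..?m} = ({1..a} \<union> {a + k + 1..?m}) \<union> {a + 1..a + k}" using ak by auto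
  then have un: "{1..?n} = ?J \<union> f ` {a + 1..a + k}"
    using labelled_walkD(1)[OF f] by (metis image_Un)
  have "f ` {a + 1..a + k} \<subseteq> ?J"
    using cover
  proof (elim disjE conjE)
    assume pal: "palindrome_at u c l" and sub: "f ` {a + 1..a + k} \<subseteq> {c..c + l}"
    \<comment> \<open>If \<open>c + l\<close> is missed, so is everything above it. Then the last
      position of \<open>u\<close> is visited only in the block, which does not go beyond
      \<open>c + l\<close>; so \<open>u\<close> ends there, with a palindromic suffix.\<close>
    have "c + l \<in> ?J"
    proof (rule ccontr)
      assume *: "c + l \<notin> ?J"
      have "c + l \<le> ?n" using pal by (simp add: palindrome_at_def)
      then have "?n \<notin> ?J" using interval[OF c, of ?n "c + l"] * by linarith
      moreover have "?n \<in> {1..?n}" using pal by (auto simp: palindrome_at_def)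
      ultimately have "?n \<in> {c..c + l}" using un sub by blast
      then have "c = ?n - l" using pal by (auto simp: palindrome_at_def)
      then show False using palindrome_suffix_not_primitive[OF l] pal prim by blast
    qed
    from interval[OF c this] sub show ?thesis by (meson atLeastAtMost_iff subset_iff)
  next
    assume pal: "palindrome_at u c l" and sub: "f ` {a + 1..a + k} \<subseteq> {c - l..c}"
    have "c - l \<in> ?J"
    proof (rule ccontr)
      assume *: "c - l \<notin> ?J"
      have "1 \<le> c - l" using pal by (auto simp: palindrome_at_def)
      then have "1 \<notin> ?J" using interval[OF _ c, of 1 "c - l"] * by linarith
      moreover have "1 \<in> {1..?n}" using pal by (auto simp: palindrome_at_def)
      ultimately have "1 \<in> {c - l..c}" using un sub by blast
      then have "c = l + 1" using pal by (auto simp: palindrome_at_def)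
      then show False using palindrome_prefix_not_primitive[OF l] pal prim by blast
    qed
    from interval[OF this c] sub show ?thesis by (meson atLeastAtMost_iff subset_iff)
  qed
  then have "?g ` {1..?m - k} = {1..?n}" unfolding J using un by (simp add: Un_absorb2)
  moreover have "?w ! (i - 1) = u ! (?g i - 1)" if i: "1 \<le> i" "i \<le> ?m - k" for i
  proof (cases "i \<le> a")
    case True
    then show ?thesis using i ak labelled_walkD(3)[OF f, of i] by (auto simp: nth_append)
  next
    case False
    have "?w ! (i - 1) = w ! (i + k - 1)"
      using False i ak by (auto simp: nth_append min_def intro!: arg_cong[where f = "(!) w"])
    then show ?thesis using False i ak labelled_walkD(3)[OF f, of "i + k"] by auto
  qed
  ultimately have "labelled_walk u ?w ?g"
    unfolding labelled_walk_def walk_def len using step by blast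
  then show ?thesis by (auto simp: generates_iff_labelled_walk)
qed

subsection \<open>Turns and folds\<close>

text \<open>Meant for walks with \<open>unit_steps\<close>, where it says that the direction is
  reversed at \<open>p\<close>.\<close>

definition turn :: "nat \<Rightarrow> (nat \<Rightarrow> nat) \<Rightarrow> nat \<Rightarrow> bool" where
  "turn m f p \<longleftrightarrow> 1 < p \<and> p < m \<and> f (p - 1) = f (p + 1)"

definition unit_steps :: "nat \<Rightarrow> (nat \<Rightarrow> nat) \<Rightarrow> bool" where
  "unit_steps m f \<longleftrightarrow> (\<forall>i. 1 \<le> i \<and> i < m \<longrightarrow> \<bar>int (f (i + 1)) - int (f i)\<bar> = 1)"

text \<open>Two consecutive unit steps in opposite directions form a turn, so between turns the
  direction \<open>d\<close> is constant.\<close>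

lemma straight:
  assumes unit: "unit_steps m f" and pq: "1 \<le> p" "q \<le> m"
    and no_turn: "\<And>i. p < i \<Longrightarrow> i < q \<Longrightarrow> \<not> turn m f i"
  obtains d :: int where "d = 1 \<or> d = -1"
    "\<And>i. p \<le> i \<Longrightarrow> i \<le> q \<Longrightarrow> int (f i) = int (f p) + d * (int i - int p)"
proof -
  \<comment> \<open>For \<open>p \<ge> q\<close> there is no step to read the direction from, and 1
    is taken as a default.\<close>
  define d where "d = (if p < q then int (f (p + 1)) - int (f p) else 1)"
  have step: "\<bar>int (f (i + 1)) - int (f i)\<bar> = 1" if "p \<le> i" "i < q" for i
    using unit pq that by (auto simp: unit_steps_def)
  have d: "d = 1 \<or> d = -1" using step[of p] by (auto simp: d_def)
  have const: "i < q \<Longrightarrow> int (f (i + 1)) - int (f i) = d" if "p \<le> i" for i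
    using that
  proof (induction i rule: dec_induct)
    case (step i)
    have "f i \<noteq> f (i + 2)"
      using no_turn[of "i + 1"] step pq by (auto simp: turn_def)
    then show ?case
      using step d assms(1) pq by (auto simp: unit_steps_def dest!: spec[of _ "i + 1"])
  qed (simp add: d_def)
  have "i \<le> q \<Longrightarrow> int (f i) = int (f p) + d * (int i - int p)" if "p \<le> i" for i
    using that
  proof (induction i rule: dec_induct)
    case (step i)
    then show ?case using const[of i] by (simp add: algebra_simps)
  qed simp
  then show thesis using that d by blast
qed

text \<open>\<open>straight\<close> recentred at \<open>c\<close>. For \<open>k > 0\<close> the
  assumption on turns also excludes \<open>c\<close> itself.\<close>

lemma straight_around:
  assumes unit: "unit_steps m f" and c: "k < c" "c + k \<le> m"
    and no_turn: "\<And>i. turn m f i \<Longrightarrow> c + k \<le> i \<or> i + k \<le> c"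
  obtains d :: int where "d = 1 \<or> d = -1"
    "\<And>i. i \<le> k \<Longrightarrow> int (f (c + i)) = int (f c) + d * int i"
    "\<And>i. i \<le> k \<Longrightarrow> int (f (c - i)) = int (f c) - d * int i"
proof -
  have nt: "\<not> turn m f i" if "c - k < i" "i < c + k" for i
    using no_turn[of i] that by auto
  have "1 \<le> c - k" using c by simp
  then obtain d :: int where d: "d = 1 \<or> d = -1"
    and e: "\<And>i. c - k \<le> i \<Longrightarrow> i \<le> c + k \<Longrightarrow>
      int (f i) = int (f (c - k)) + d * (int i - int (c - k))"
    using straight[OF unit _ c(2) nt, of "c - k"] by metis
  show thesis
  proof (rule that[OF d])
    fix i assume i: "i \<le> k"
    show "int (f (c + i)) = int (f c) + d * int i"
      using e[of "c + i"] e[of c] i by (simp add: algebra_simps trans_le_add1)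
    show "int (f (c - i)) = int (f c) - d * int i"
      using e[of "c - i"] e[of c] i c by (simp add: algebra_simps of_nat_diff)
  qed
qed

text \<open>Both sides of \<open>c\<close> are straight, and the turn makes their directions
  opposite.\<close>

lemma turn_reflects:
  assumes unit: "unit_steps m f" and c: "k < c" "c + k \<le> m" and turn: "turn m f c"
    and no_turn: "\<And>i. turn m f i \<Longrightarrow> i \<noteq> c \<Longrightarrow> c + k \<le> i \<or> i + k \<le> c"
    and i: "i \<le> k"
  shows "f (c - i) = f (c + i)"
proof (cases "i = 0")
  case False
  have nt: "\<not> turn m f j" if "c < j \<and> j < c + k \<or> c - k < j \<and> j < c" for j
    using no_turn[of j] that by auto
  have "1 \<le> c - k" "c \<le> m" "1 \<le> c" using c by auto
  obtain d :: int where
    d: "\<And>i. c - k \<le> i \<Longrightarrow> i \<le> c \<Longrightarrow> int (f i) = int (f (c - k)) + d * (int i - int (c - k))"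
    using straight[OF unit \<open>1 \<le> c - k\<close> \<open>c \<le> m\<close>] nt by metis
  obtain e :: int where
    e: "\<And>i. c \<le> i \<Longrightarrow> i \<le> c + k \<Longrightarrow> int (f i) = int (f c) + e * (int i - int c)"
    using straight[OF unit \<open>1 \<le> c\<close> c(2)] nt by metis
  have d': "int (f (c - j)) = int (f c) - d * int j" if "j \<le> k" for j
    using d[of "c - j"] d[of c] that c by (simp add: algebra_simps of_nat_diff)
  \<comment> \<open>The turn is used at distance 1 from \<open>c\<close>; this distance is available
    because \<open>0 < i\<close> and \<open>i \<le> k\<close>.\<close>
  have "d = - e" using d'[of 1] e[of "c + 1"] turn False i by (simp add: turn_def)
  then show ?thesis using d'[OF i] e[of "c + i"] i by simp
qed simp

text \<open>Length 0 is excluded because every single letter is a palindrome of radius 0.\<close>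

definition fold_at :: "'a list \<Rightarrow> nat \<Rightarrow> bool" where
  "fold_at w l \<longleftrightarrow> 1 \<le> l \<and>
     (palindrome_at w (l + 1) l \<or> palindrome_at w (length w - l) l \<or>
      (\<exists>s. palindrome_at w s l \<and> palindrome_at w (s + l) l))"

lemma fold_at_rev:
  assumes "fold_at w l"
  shows "fold_at (rev w) l"
proof -
  consider "palindrome_at w (l + 1) l" | "palindrome_at w (length w - l) l"
    | s where "palindrome_at w s l" "palindrome_at w (s + l) l"
    using assms by (auto simp: fold_at_def)
  then show ?thesis
  proof cases
    case 1
    then show ?thesis using assms palindrome_at_rev[OF 1] by (simp add: fold_at_def)
  next
    case 2
    have "length w + 1 - (length w - l) = l + 1" using 2 by (auto simp: palindrome_at_def)
    then show ?thesis using assms palindrome_at_rev[OF 2] by (simp add: fold_at_def)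
  next
    case (3 s)
    have "length w + 1 - s = length w + 1 - (s + l) + l"
      using 3 by (auto simp: palindrome_at_def)
    then show ?thesis
      using assms palindrome_at_rev[OF 3(1)] palindrome_at_rev[OF 3(2)]
      unfolding fold_at_def by metis
  qed
qed

lemma fold_at_rev_iff: "fold_at (rev w) l \<longleftrightarrow> fold_at w l"
  using fold_at_rev[of w l] fold_at_rev[of "rev w" l] by auto

text \<open>Two centres at distance less than \<open>l\<close>, with their radii cut down to that
  distance, would form an inner fold shorter than \<open>l\<close>.\<close>

lemma centres_apart:
  assumes no_fold: "\<And>j. j < l \<Longrightarrow> \<not> fold_at w j"
    and "palindrome_at w c l" "palindrome_at w q l" "c \<noteq> q"
  shows "c + l \<le> q \<or> q + l \<le> c"
proof -
  have *: "c + l \<le> q" if "palindrome_at w c l" "palindrome_at w q l" "c < q" for c q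
  proof (rule ccontr)
    assume lt: "\<not> c + l \<le> q"
    have "palindrome_at w c (q - c)" "palindrome_at w (c + (q - c)) (q - c)"
      using that lt by (auto elim: palindrome_at_mono)
    then have "fold_at w (q - c)" using that unfolding fold_at_def by auto
    then show False using no_fold[of "q - c"] lt that by auto
  qed
  show ?thesis using *[of c q] *[of q c] assms by linarith
qed

text \<open>A turn whose palindrome cannot be enlarged is blocked by an end of the word or by another
  turn; either way a fold of that radius appears.\<close>

lemma turn_radius:
  assumes f: "labelled_walk u w f" and unit: "unit_steps (length w) f"
    and no_fold: "\<And>j. j < l \<Longrightarrow> \<not> fold_at w j"
    and "turn (length w) f p" "k \<le> l"
  shows "palindrome_at w p k"
  using assms(4,5)
proof (induction k arbitrary: p)
  case 0
  then show ?case by (auto simp: turn_def palindrome_at_def)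
next
  case (Suc k)
  let ?m = "length w"
  \<comment> \<open>The induction hypothesis is needed for all turns, since neighbouring turns must
    be kept away from \<open>p\<close>.\<close>
  have pal: "palindrome_at w q k" if "turn ?m f q" for q using Suc that by simp
  have nf: "\<not> fold_at w k" using no_fold[of k] Suc by simp
  have p: "1 < p" "p < ?m" "k < p" "p + k \<le> ?m"
    using Suc pal[of p] by (auto simp: turn_def palindrome_at_def)
  have "p \<noteq> k + 1"
  proof
    assume "p = k + 1"
    then show False using pal[OF Suc.prems(1)] nf p by (simp add: fold_at_def)
  qed
  moreover have "p + k \<noteq> ?m"
  proof
    assume *: "p + k = ?m"
    then have "p = ?m - k" by simp
    then show False using pal[OF Suc.prems(1)] nf p * by (simp add: fold_at_def)
  qed
  ultimately have bounds: "Suc k < p" "p + Suc k \<le> ?m" using p by auto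
  have apart: "p + Suc k \<le> q \<or> q + Suc k \<le> p" if q: "turn ?m f q" "q \<noteq> p" for q
  proof -
    have "p + k \<le> q \<or> q + k \<le> p"
      using centres_apart[of k w p q] no_fold pal q Suc.prems by auto
    \<comment> \<open>Two turns at distance exactly \<open>k\<close> would be the centres of an
      inner fold of length \<open>k\<close>.\<close>
    moreover have "q \<noteq> p + k" and "p \<noteq> q + k"
      using nf pal[OF Suc.prems(1)] pal[OF q(1)] q(2) unfolding fold_at_def by auto
    ultimately show ?thesis by linarith
  qed
  have "w ! (p - i - 1) = w ! (p + i - 1)" if i: "i \<le> Suc k" for i
  proof -
    have "f (p - i) = f (p + i)"
      by (rule turn_reflects[OF unit bounds Suc.prems(1) apart i])
    then show ?thesis
      using labelled_walkD(3)[OF f, of "p - i"] labelled_walkD(3)[OF f, of "p + i"] bounds i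
      by simp
  qed
  then show ?case using bounds by (simp add: palindrome_at_def)
qed

section \<open>Cutting a fold of minimal length out of a word\<close>

text \<open>Around \<open>c\<close> the walk copies \<open>w\<close> onto \<open>u\<close>, forwards
  or mirrored, so the palindrome carries over. It fits into \<open>u\<close> because the walk visits
  both ends.\<close>

lemma straight_palindrome:
  assumes f: "labelled_walk u w f" and pal: "palindrome_at w c l"
    and d: "d = 1 \<or> d = -1"
      "\<And>i. i \<le> l \<Longrightarrow> int (f (c + i)) = int (f c) + d * int i"
      "\<And>i. i \<le> l \<Longrightarrow> int (f (c - i)) = int (f c) - d * int i"
  shows "palindrome_at u (f c) l"
proof -
  have c: "l < c" "c + l \<le> length w"
    and e: "\<And>i. i \<le> l \<Longrightarrow> w ! (c - i - 1) = w ! (c + i - 1)"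
    using pal by (auto simp: palindrome_at_def)
  have "1 \<le> f (c - l) \<and> f (c - l) \<le> length u" "1 \<le> f (c + l) \<and> f (c + l) \<le> length u"
    using labelled_walkD(4)[OF f] c by auto
  then have bounds: "l < f c" "f c + l \<le> length u"
    using d(1) d(2)[of l] d(3)[of l] by auto
  have "u ! (f c - i - 1) = u ! (f c + i - 1)" if i: "i \<le> l" for i
  proof -
    have "u ! (f (c - i) - 1) = u ! (f (c + i) - 1)"
      using labelled_walkD(3)[OF f, of "c - i"] labelled_walkD(3)[OF f, of "c + i"] e[OF i] c i
      by simp
    moreover have "f (c - i) = f c - i \<and> f (c + i) = f c + i \<or>
        f (c - i) = f c + i \<and> f (c + i) = f c - i"
      using d(1) d(2,3)[OF i] bounds i by auto
    ultimately show ?thesis by auto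
  qed
  then show ?thesis using bounds by (simp add: palindrome_at_def)
qed

text \<open>If the walk turns at the centre \<open>l + 1\<close>, the first \<open>l\<close> values
  recur mirrored behind it. Otherwise the walk is straight there, and the palindrome passes to
  \<open>u\<close>. These are the two alternatives of \<open>delete_block\<close>.\<close>

lemma remove_prefix_fold:
  assumes f: "labelled_walk u w f" and unit: "unit_steps (length w) f"
    and prim: "primitive_word u"
    and no_fold: "\<And>j. j < l \<Longrightarrow> \<not> fold_at w j"
    and l: "1 \<le> l" and pal: "palindrome_at w (l + 1) l"
  shows "generates u (drop l w)"
proof -
  let ?m = "length w" and ?c = "l + 1"
  \<comment> \<open>The zeros match \<open>delete_block\<close> with \<open>a = 0\<close>.\<close>
  let ?J = "f ` ({1..0} \<union> {0 + l + 1..?m})"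
  have m: "l < ?c" "?c + l \<le> ?m" using pal by (auto simp: palindrome_at_def)
  have apart: "?c + l \<le> q \<or> q + l \<le> ?c" if "turn ?m f q" "q \<noteq> ?c" for q
    using centres_apart[OF no_fold pal turn_radius[OF f unit no_fold that(1)]] that by auto
  have "f ` {0 + 1..0 + l} \<subseteq> ?J \<or> palindrome_at u (f ?c) l \<and>
      (f ` {0 + 1..0 + l} \<subseteq> {f ?c..f ?c + l} \<or> f ` {0 + 1..0 + l} \<subseteq> {f ?c - l..f ?c})"
  proof (cases "turn ?m f ?c")
    case True
    have "f j \<in> ?J" if j: "j \<in> {0 + 1..0 + l}" for j
    proof -
      have "f (?c - (?c - j)) = f (?c + (?c - j))"
        using j by (intro turn_reflects[OF unit m True apart]) auto
      then show ?thesis using j m by (intro image_eqI[where x = "?c + (?c - j)"]) auto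
    qed
    then show ?thesis by blast
  next
    case False
    obtain d :: int where d: "d = 1 \<or> d = -1"
      "\<And>i. i \<le> l \<Longrightarrow> int (f (?c + i)) = int (f ?c) + d * int i"
      "\<And>i. i \<le> l \<Longrightarrow> int (f (?c - i)) = int (f ?c) - d * int i"
      using straight_around[OF unit m] apart False by metis
    have val: "int (f j) = int (f ?c) - d * int (?c - j)" if "j \<in> {0 + 1..0 + l}" for j
      using d(3)[of "?c - j"] that by auto
    have "f ` {0 + 1..0 + l} \<subseteq> {f ?c..f ?c + l} \<or> f ` {0 + 1..0 + l} \<subseteq> {f ?c - l..f ?c}"
      using d(1)
    proof
      assume "d = 1"
      then have "f j \<in> {f ?c - l..f ?c}" if "j \<in> {0 + 1..0 + l}" for j
        using val[OF that] that by auto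
      then show ?thesis by blast
    next
      assume "d = -1"
      then have "f j \<in> {f ?c..f ?c + l}" if "j \<in> {0 + 1..0 + l}" for j
        using val[OF that] that by auto
      then show ?thesis by blast
    qed
    then show ?thesis using straight_palindrome[OF f pal d] by blast
  qed
  moreover have "f ?c \<in> ?J" using m by auto
  ultimately have "generates u (take 0 w @ drop (0 + l) w)"
    using m by (intro delete_block[OF f prim _ _ l]) auto
  then show ?thesis by simp
qed

text \<open>The walk may turn at \<open>s\<close>, at \<open>s + l\<close>, at both or at neither. A
  turn at either centre closes a block of length \<open>2 * l\<close> around it, which can be cut;
  with no turn at all the fold would reappear in \<open>u\<close>.\<close>

lemma remove_inner_fold:
  assumes f: "labelled_walk u w f" and unit: "unit_steps (length w) f"
    and prim: "primitive_word u"
    and no_fold: "\<And>j. j < l \<Longrightarrow> \<not> fold_at w j"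
    and l: "1 \<le> l" and pal_s: "palindrome_at w s l" and pal_t: "palindrome_at w (s + l) l"
  shows "generates u (take s w @ drop (s + 2 * l) w)"
proof -
  let ?m = "length w" and ?t = "s + l"
  have m: "l < s" "s + l \<le> ?m" "l < ?t" "?t + l \<le> ?m"
    using pal_s pal_t by (auto simp: palindrome_at_def)
  have apart: "c + l \<le> q \<or> q + l \<le> c"
    if "palindrome_at w c l" "turn ?m f q" "q \<noteq> c" for c q
    using centres_apart[OF no_fold that(1) turn_radius[OF f unit no_fold that(2)]] that by auto
  have straight_at: thesis
    if c: "palindrome_at w c l" and nt: "\<not> turn ?m f c"
      and *: "\<And>d :: int. d = 1 \<or> d = -1 \<Longrightarrow>
        (\<And>i. i \<le> l \<Longrightarrow> int (f (c + i)) = int (f c) + d * int i) \<Longrightarrow>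
        (\<And>i. i \<le> l \<Longrightarrow> int (f (c - i)) = int (f c) - d * int i) \<Longrightarrow>
        palindrome_at u (f c) l \<Longrightarrow> thesis" for c thesis
  proof -
    have "l < c" "c + l \<le> ?m" using c by (auto simp: palindrome_at_def)
    then obtain d :: int where d: "d = 1 \<or> d = -1"
      "\<And>i. i \<le> l \<Longrightarrow> int (f (c + i)) = int (f c) + d * int i"
      "\<And>i. i \<le> l \<Longrightarrow> int (f (c - i)) = int (f c) - d * int i"
      using straight_around[OF unit] apart[OF c] nt by metis
    show thesis using *[OF d straight_palindrome[OF f c d]] .
  qed
  have refl_at: "f (c - i) = f (c + i)"
    if c: "palindrome_at w c l" and "turn ?m f c" "i \<le> l" for c i
    using c that apart[OF c] by (intro turn_reflects[OF unit, of l]) (auto simp: palindrome_at_def)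
  consider (t) "turn ?m f ?t" | (s) "turn ?m f s" "\<not> turn ?m f ?t"
    | (none) "\<not> turn ?m f s" "\<not> turn ?m f ?t" by blast
  then show ?thesis
  proof cases
    case t
    note rt = refl_at[OF pal_t t]
    let ?J = "f ` ({1..s} \<union> {s + 2 * l + 1..?m})"
    \<comment> \<open>Reflection in \<open>?t\<close>, with positions measured from
      \<open>s\<close>.\<close>
    have high: "f (s + j) = f (s + (2 * l - j))" if "l < j" "j \<le> 2 * l" for j
    proof -
      have "?t + (j - l) = s + j" "?t - (j - l) = s + (2 * l - j)" using that by auto
      then show ?thesis using rt[of "j - l"] that by simp
    qed
    have closed: "f s = f (s + 2 * l)" using high[of "2 * l"] l by simp
    have block: "\<exists>j \<le> l. f i = f (s + j)" if "i \<in> {s + 1..s + 2 * l}" for i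
    proof (cases "i \<le> s + l")
      case True
      then show ?thesis using that by (intro exI[of _ "i - s"]) auto
    next
      case False
      then show ?thesis
        using high[of "i - s"] that by (intro exI[of _ "2 * l - (i - s)"]) auto
    qed
    \<comment> \<open>By \<open>block\<close> only the values on \<open>s\<close> to
      \<open>s + l\<close> matter: a turn at \<open>s\<close> mirrors them to the left of
      \<open>s\<close>, and otherwise they lie on one side of \<open>f s\<close>.\<close>
    have "f ` {s + 1..s + 2 * l} \<subseteq> ?J \<or> palindrome_at u (f s) l \<and>
      (f ` {s + 1..s + 2 * l} \<subseteq> {f s..f s + l} \<or> f ` {s + 1..s + 2 * l} \<subseteq> {f s - l..f s})"
    proof (cases "turn ?m f s")
      case True
      have "f i \<in> ?J" if i: "i \<in> {s + 1..s + 2 * l}" for i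
      proof -
        obtain j where j: "j \<le> l" "f i = f (s + j)" using block[OF i] by blast
        then have "f i = f (s - j)" using refl_at[OF pal_s True] by simp
        then show ?thesis using j m by auto
      qed
      then show ?thesis by blast
    next
      case False
      obtain d :: int where d: "d = 1 \<or> d = -1"
        "\<And>i. i \<le> l \<Longrightarrow> int (f (s + i)) = int (f s) + d * int i"
        and pal: "palindrome_at u (f s) l"
        using straight_at[OF pal_s False] by metis
      have "f ` {s + 1..s + 2 * l} \<subseteq> {f s..f s + l} \<or> f ` {s + 1..s + 2 * l} \<subseteq> {f s - l..f s}"
        using d(1)
      proof
        assume "d = 1"
        then have "f i \<in> {f s..f s + l}" if "i \<in> {s + 1..s + 2 * l}" for i
          using block[OF that] d(2) by force
        then show ?thesis by blast
      next
        assume "d = -1"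
        then have "f i \<in> {f s - l..f s}" if "i \<in> {s + 1..s + 2 * l}" for i
          using block[OF that] d(2) by force
        then show ?thesis by blast
      qed
      then show ?thesis using pal by blast
    qed
    moreover have "f s \<in> ?J" using m by auto
    ultimately show ?thesis using m closed by (intro delete_block[OF f prim _ _ l]) auto
  next
    case s
    note rs = refl_at[OF pal_s s(1)]
    \<comment> \<open>The block is now centred at the turn \<open>s\<close>. Its values are those
      taken on \<open>s\<close> to \<open>?t\<close>, which lie on one side of
      \<open>f ?t\<close>.\<close>
    let ?a = "s - l"
    let ?J = "f ` ({1..?a} \<union> {?a + 2 * l + 1..?m})"
    have closed: "f ?a = f (?a + 2 * l)" using rs[of l] m by (simp add: add.commute)
    have block: "\<exists>j \<le> l. f i = f (?t - j)" if i: "i \<in> {?a + 1..?a + 2 * l}" for i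
    proof (cases "s \<le> i")
      case True
      then have "?t - (?t - i) = i" "?t - i \<le> l" using i m by auto
      then show ?thesis by metis
    next
      case False
      then have "f i = f (s + (s - i))" using rs[of "s - i"] i by auto
      moreover have "?t - (l - (s - i)) = s + (s - i)" using False i m by auto
      ultimately show ?thesis by (intro exI[of _ "l - (s - i)"]) auto
    qed
    obtain d :: int where d: "d = 1 \<or> d = -1"
      "\<And>i. i \<le> l \<Longrightarrow> int (f (?t - i)) = int (f ?t) - d * int i"
      and pal: "palindrome_at u (f ?t) l"
      using straight_at[OF pal_t s(2)] by metis
    have "f ` {?a + 1..?a + 2 * l} \<subseteq> {f ?t..f ?t + l} \<or>
        f ` {?a + 1..?a + 2 * l} \<subseteq> {f ?t - l..f ?t}"
      using d(1)
    proof
      assume "d = 1"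
      then have "f i \<in> {f ?t - l..f ?t}" if "i \<in> {?a + 1..?a + 2 * l}" for i
        using block[OF that] d(2) by force
      then show ?thesis by blast
    next
      assume "d = -1"
      then have "f i \<in> {f ?t..f ?t + l}" if "i \<in> {?a + 1..?a + 2 * l}" for i
        using block[OF that] d(2) by force
      then show ?thesis by blast
    qed
    moreover have "f ?t \<in> ?J"
    proof -
      have "f ?t = f ?a" using rs[of l] by simp
      then show ?thesis using m by auto
    qed
    ultimately have "generates u (take ?a w @ drop (?a + 2 * l) w)"
      using m closed pal by (intro delete_block[OF f prim _ _ l]) auto
    \<comment> \<open>Cutting around \<open>s\<close> or around \<open>?t\<close> gives the same
      word: the retained pieces of length \<open>l\<close> agree by the period
      \<open>2 * l\<close>.\<close>
    moreover have "take ?a w @ drop (?a + 2 * l) w = take s w @ drop (s + 2 * l) w"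
    proof (rule nth_equalityI)
      fix i assume "i < length (take ?a w @ drop (?a + 2 * l) w)"
      then have i: "i < ?m - 2 * l" using m by auto
      consider "i < ?a" | "?a \<le> i" "i < s" | "s \<le> i" by linarith
      then show "(take ?a w @ drop (?a + 2 * l) w) ! i = (take s w @ drop (s + 2 * l) w) ! i"
      proof cases
        case 2
        have "w ! (i + 2 * l) = w ! i"
        proof -
          have "s + l + (i + 1 - ?a) - 1 = i + 2 * l" "s - l + (i + 1 - ?a) - 1 = i"
            "i + 1 - ?a \<le> l"
            using 2 m by auto
          then show ?thesis
            using double_palindrome_period[OF pal_s pal_t, of "i + 1 - ?a"] by metis
        qed
        moreover have "?a + 2 * l + (i - ?a) = i + 2 * l" using 2 m by auto
        ultimately show ?thesis using 2 m i by (simp add: nth_append min_def mult_2 add_ac)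
      next
        case 3
        have "min ?m s = s" "min ?m ?a = ?a" using 3 m i by auto
        moreover have "?a + 2 * l + (i - ?a) = i + 2 * l" "s + 2 * l + (i - s) = i + 2 * l"
          using 3 m by auto
        ultimately show ?thesis using 3 m i by (auto simp: nth_append mult_2 add_ac)
      qed (use m in \<open>auto simp: nth_append min_def\<close>)
    qed (use m in auto)
    ultimately show ?thesis by simp
  next
    case none
    obtain d :: int where d: "d = 1 \<or> d = -1"
      "\<And>i. i \<le> l \<Longrightarrow> int (f (s + i)) = int (f s) + d * int i"
      and ps: "palindrome_at u (f s) l"
      using straight_at[OF pal_s none(1)] by metis
    have pt: "palindrome_at u (f ?t) l"
      using straight_at[OF pal_t none(2)] by metis
    \<comment> \<open>Being straight, the walk carries the two centres to positions of
      \<open>u\<close> at distance \<open>l\<close>, in one order or the other.\<close>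
    have "f ?t = f s + l \<or> f s = f ?t + l" using d(1) d(2)[of l] by auto
    then have "\<not> primitive_word u"
      using double_palindrome_not_primitive[OF l] ps pt by metis
    then show ?thesis using prim by blast
  qed
qed

section \<open>Stutters, and words with neither stutter nor fold\<close>

lemma unit_steps_if_no_stutter:
  assumes f: "labelled_walk u w f"
    and no_stutter: "\<And>i. 1 \<le> i \<Longrightarrow> i < length w \<Longrightarrow> w ! (i - 1) \<noteq> w ! i"
  shows "unit_steps (length w) f"
  unfolding unit_steps_def
proof (intro allI impI)
  fix i assume i: "1 \<le> i \<and> i < length w"
  have "f (i + 1) \<noteq> f i"
    using no_stutter[of i] labelled_walkD(3)[OF f, of i] labelled_walkD(3)[OF f, of "i + 1"] i
    by auto
  then show "\<bar>int (f (i + 1)) - int (f i)\<bar> = 1" using labelled_walkD(2)[OF f, of i] i by linarith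
qed

text \<open>Adjacent letters of a primitive word differ, so the walk can only pause at a stutter,
  and the pause can be cut.\<close>

lemma remove_stutter:
  assumes f: "labelled_walk u w f" and prim: "primitive_word u"
    and i: "1 \<le> i" "i < length w" "w ! (i - 1) = w ! i"
  shows "generates u (take i w @ drop (i + 1) w)"
proof -
  have lab: "u ! (f i - 1) = u ! (f (i + 1) - 1)"
    using labelled_walkD(3)[OF f, of i] labelled_walkD(3)[OF f, of "i + 1"] i by simp
  have bounds: "1 \<le> f i" "f i \<le> length u" "1 \<le> f (i + 1)" "f (i + 1) \<le> length u"
    using labelled_walkD(4)[OF f, of i] labelled_walkD(4)[OF f, of "i + 1"] i by auto
  have "f i = f (i + 1)"
  proof (rule ccontr)
    assume "f i \<noteq> f (i + 1)"
    then have "f (i + 1) = f i + 1 \<or> f i = f (i + 1) + 1"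
      using labelled_walkD(2)[OF f, of i] i by linarith
    then show False
      using stutter_not_primitive[of "f i" u] stutter_not_primitive[of "f (i + 1)" u]
        lab bounds prim by auto
  qed
  moreover have "f i \<in> f ` ({1..i} \<union> {i + 1 + 1..length w})" using i by auto
  ultimately show ?thesis
    using i by (intro delete_block[OF f prim _ _ order_refl, where c = "f i"]) auto
qed

text \<open>Without folds a turn would have unbounded radius, so the walk is straight; being onto,
  it is the identity or the reversal.\<close>

lemma straight_generator:
  assumes f: "labelled_walk u w f" and unit: "unit_steps (length w) f"
    and no_fold: "\<And>l. \<not> fold_at w l"
  shows "u = w \<or> u = rev w"
proof (cases "w = []")
  case True
  then show ?thesis using labelled_walkD(1)[OF f] by (cases u) auto
next
  case False
  let ?m = "length w" and ?n = "length u"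
  have m: "1 \<le> ?m" using False by (cases w) auto
  have "\<not> turn ?m f p" for p
  proof
    assume "turn ?m f p"
    \<comment> \<open>Radius \<open>p\<close> is already impossible, as it would need
      \<open>p < p\<close>.\<close>
    then have "palindrome_at w p p" using turn_radius[OF f unit] no_fold by blast
    then show False by (simp add: palindrome_at_def)
  qed
  then obtain d :: int where d: "d = 1 \<or> d = -1"
    and val: "\<And>i. 1 \<le> i \<Longrightarrow> i \<le> ?m \<Longrightarrow> int (f i) = int (f 1) + d * (int i - 1)"
    using straight[OF unit, of 1 ?m] by auto
  have bounds: "1 \<le> f i \<and> f i \<le> ?n" if "1 \<le> i" "i \<le> ?m" for i
    using labelled_walkD(4)[OF f] that by blast
  have "1 \<le> ?n" using bounds[of 1] m by auto
  then have "1 \<in> f ` {1..?m}" "?n \<in> f ` {1..?m}" using labelled_walkD(1)[OF f] by auto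
  then obtain p q where pq: "1 \<le> p" "p \<le> ?m" "f p = 1" "1 \<le> q" "q \<le> ?m" "f q = ?n"
    by force
  show ?thesis
    using d
  proof
    assume d: "d = 1"
    have "f 1 = 1" using val[OF pq(1,2)] pq bounds[of 1] m d by auto
    moreover have "?n = ?m" using val[OF pq(4,5)] val[of ?m] bounds[of ?m] pq m d calculation by auto
    ultimately have "w ! j = u ! j" if "j < ?m" for j
    proof -
      have "f (j + 1) = j + 1" using val[of "j + 1"] that d \<open>f 1 = 1\<close> by auto
      then show ?thesis using labelled_walkD(3)[OF f, of "j + 1"] that by simp
    qed
    then show ?thesis using \<open>?n = ?m\<close> by (simp add: list_eq_iff_nth_eq)
  next
    assume d: "d = -1"
    have "f 1 = ?m" using val[OF pq(1,2)] val[of ?m] pq bounds[of ?m] m d by auto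
    moreover have "?n = ?m" using val[OF pq(4,5)] bounds[of 1] pq m d calculation by auto
    ultimately have "w ! j = u ! (?m - 1 - j)" if "j < ?m" for j
    proof -
      have "f (j + 1) = ?m - j" using val[of "j + 1"] that d \<open>f 1 = ?m\<close> by auto
      then show ?thesis using labelled_walkD(3)[OF f, of "j + 1"] that by simp
    qed
    then have "w = rev u" using \<open>?n = ?m\<close> by (simp add: list_eq_iff_nth_eq rev_nth)
    then show ?thesis by simp
  qed
qed

section \<open>Descent to a shorter word, and uniqueness\<close>

text \<open>The order of quantifiers is the point: \<open>w'\<close> is chosen from \<open>w\<close>
  alone, so any two primitive generators of \<open>w\<close> descend to the same word.\<close>

lemma primitive_generators_descend:
  assumes "(\<exists>i. 1 \<le> i \<and> i < length w \<and> w ! (i - 1) = w ! i) \<or> (\<exists>l. fold_at w l)"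
  obtains w' where "length w' < length w"
    "\<And>u. primitive_generator u w \<Longrightarrow> primitive_generator u w'"
proof (cases "\<exists>i. 1 \<le> i \<and> i < length w \<and> w ! (i - 1) = w ! i")
  case True
  then obtain i where i: "1 \<le> i" "i < length w" "w ! (i - 1) = w ! i" by blast
  show thesis
  proof (rule that[of "take i w @ drop (i + 1) w"])
    show "length (take i w @ drop (i + 1) w) < length w" using i by auto
  qed (use remove_stutter[OF _ _ i] in
      \<open>auto simp: primitive_generator_def generates_iff_labelled_walk\<close>)
next
  case no_stutter: False
  then obtain l where l: "fold_at w l" and no_fold: "\<And>j. j < l \<Longrightarrow> \<not> fold_at w j"
    using assms exists_least_iff[of "fold_at w"] by auto
  have l1: "1 \<le> l" using l by (simp add: fold_at_def)
  have unit: "unit_steps (length w) f" if "labelled_walk u w f" for u :: "'a list" and f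
    using unit_steps_if_no_stutter[OF that] no_stutter by blast
  have rev_unit: "unit_steps (length (rev w)) f" if f: "labelled_walk u (rev w) f"
    for u :: "'a list" and f
  proof (rule unit_steps_if_no_stutter[OF f])
    fix i assume i: "1 \<le> i" "i < length (rev w)"
    then have "rev w ! (i - 1) = w ! (length w - i)" "rev w ! i = w ! (length w - i - 1)"
      by (simp_all add: rev_nth)
    moreover have "w ! (length w - i - 1) \<noteq> w ! (length w - i)"
    proof -
      have "1 \<le> length w - i" "length w - i < length w" using i by auto
      then show ?thesis using no_stutter by blast
    qed
    ultimately show "rev w ! (i - 1) \<noteq> rev w ! i" by simp
  qed
  consider "palindrome_at w (l + 1) l" | "palindrome_at w (length w - l) l"
    | s where "palindrome_at w s l" "palindrome_at w (s + l) l"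
    using l by (auto simp: fold_at_def)
  then show thesis
  proof cases
    case 1
    show thesis
    proof (rule that[of "drop l w"])
      show "length (drop l w) < length w" using 1 l1 by (auto simp: palindrome_at_def)
    qed (use remove_prefix_fold[OF _ unit _ no_fold l1 1] in
        \<open>auto simp: primitive_generator_def generates_iff_labelled_walk\<close>)
  next
    case 2
    have "length w + 1 - (length w - l) = l + 1" using 2 by (auto simp: palindrome_at_def)
    then have pal: "palindrome_at (rev w) (l + 1) l" using palindrome_at_rev[OF 2] by simp
    have nf: "\<And>j. j < l \<Longrightarrow> \<not> fold_at (rev w) j" using no_fold by (simp add: fold_at_rev_iff)
    show thesis
    \<comment> \<open>A suffix fold is a prefix fold of \<open>rev w\<close>, and every generator of
      \<open>w\<close> also generates \<open>rev w\<close>.\<close>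
    proof (rule that[of "drop l (rev w)"])
      show "length (drop l (rev w)) < length w" using 2 l1 by (auto simp: palindrome_at_def)
      show "primitive_generator u (drop l (rev w))" if "primitive_generator u w" for u
        using that generates_rev[of u w] remove_prefix_fold[OF _ rev_unit _ nf l1 pal]
        by (auto simp: primitive_generator_def generates_iff_labelled_walk)
    qed
  next
    case (3 s)
    show thesis
    proof (rule that[of "take s w @ drop (s + 2 * l) w"])
      show "length (take s w @ drop (s + 2 * l) w) < length w"
        using 3 l1 by (auto simp: palindrome_at_def)
    qed (use remove_inner_fold[OF _ unit _ no_fold l1 3] in
        \<open>auto simp: primitive_generator_def generates_iff_labelled_walk\<close>)
  qed
qed

theorem theorem1:
  fixes u v w :: "'a list"
  assumes "primitive_generator u w"
    and "primitive_generator v w"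
  shows "u = v \<or> u = rev v"
  using assms
proof (induction w rule: length_induct)
  case (1 w)
  show ?case
  proof (cases "(\<exists>i. 1 \<le> i \<and> i < length w \<and> w ! (i - 1) = w ! i) \<or> (\<exists>l. fold_at w l)")
    case True
    then obtain w' where "length w' < length w"
      "\<And>u. primitive_generator u w \<Longrightarrow> primitive_generator u w'"
      by (rule primitive_generators_descend) blast
    then show ?thesis using 1 by blast
  next
    case False
    \<comment> \<open>Both generators lie in the pair \<open>w\<close>, \<open>rev w\<close>, so
      they are equal or reverses of each other.\<close>
    have "x = w \<or> x = rev w" if x: "primitive_generator x w" for x
    proof -
      obtain f where f: "labelled_walk x w f"
        using x by (auto simp: primitive_generator_def generates_iff_labelled_walk)
      have "unit_steps (length w) f"
        using unit_steps_if_no_stutter[OF f] False by blast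
      then show ?thesis using straight_generator[OF f] False by blast
    qed
    then show ?thesis using 1(2,3) by (metis rev_rev_ident)
  qed
qed

end
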